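(* Let $M=(M_k)$ be a log-convex weight sequence and let $\ell,m,n$ be positive integers. Then: \begin{align*} f\in\mathcal B_{\ge1}(\mathbb R^m,\mathbb R^n),\ g\in\mathcal D_{\ge1}(\mathbb R^\ell,\mathbb R^m)&\Longrightarrow f\circ g\in\mathcal D_{\ge1}(\mathbb R^\ell,\mathbb R^n),\\ f\in\mathcal B^{[M]}_{\ge1}(\mathbb R^m,\mathbb R^n),\ g\in\mathcal D^{[M]}_{\ge1}(\mathbb R^\ell,\mathbb R^m)&\Longrightarrow f\circ g\in\mathcal D^{[M]}_{\ge1}(\mathbb R^\ell,\mathbb R^n), \end{align*} where $[M]$ stands either for $(M)$ throughout or for $\{M\}$ throughout; the statement holds in both cases.
   Context: A weight sequence is a sequence $M=(M_k)_{k\in\mathbb N}$, $\mathbb N=\{0,1,\dots\}$, of positive reals with $M_0=1\le M_1$; it is log-convex if $M_k^2\le M_{k-1}M_{k+1}$ for $k\ge1$. $\mathcal B_{\ge1}(\mathbb R^m,\mathbb R^n)$: all $f\in C^\infty(\mathbb R^m,\mathbb R^n)$ with $\sup_x\|f^{(k)}(x)\|<\infty$ for all $k\ge1$ ($f^{(k)}$ the $k$-th Fréchet derivative). $\mathcal B^{(M)}_{\ge1}$ (resp. $\mathcal B^{\{M\}}_{\ge1}$): all $f\in C^\infty(\mathbb R^m,\mathbb R^n)$ such that for all (resp. some) $\rho>0$, $\sup_{k\ge1,x}\frac{\|f^{(k)}(x)\|}{\rho^kk!M_k}<\infty$. $\mathcal D(\mathbb R^m,\mathbb R^n)$ is the space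 of compactly supported $C^\infty$-mappings; $\mathcal D_{\ge1}(\mathbb R^m,\mathbb R^n):=\{f\in C^\infty(\mathbb R^m,\mathbb R^n): f^{(\alpha)}\in\mathcal D(\mathbb R^m,\mathbb R^n)\ \forall\alpha\in\mathbb N^m,|\alpha|\ge1\}$ and $\mathcal D^{[M]}_{\ge1}(\mathbb R^m,\mathbb R^n):=\mathcal D_{\ge1}(\mathbb R^m,\mathbb R^n)\cap\mathcal B^{[M]}_{\ge1}(\mathbb R^m,\mathbb R^n)$. *)

theory Defs
  imports "HOL-Analysis.Analysis"
begin

definition weight_sequence :: "(nat \<Rightarrow> real) \<Rightarrow> bool" where
  "weight_sequence M \<longleftrightarrow> (\<forall>k. 0 < M k) \<and> M 0 = 1 \<and> 1 \<le> M 1"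

definition log_convex :: "(nat \<Rightarrow> real) \<Rightarrow> bool" where
  "log_convex M \<longleftrightarrow> (\<forall>k\<ge>1. (M k)\<^sup>2 \<le> M (k - 1) * M (k + 1))"

text \<open>
  The \<open>k\<close>-th Frechet derivative takes values in a space of \<open>k\<close>-linear maps, whose type would depend
  on \<open>k\<close>. It is therefore represented in evaluated form: for a list \<open>vs\<close> of length \<open>k\<close>,
  \<open>frechet_iter f vs x\<close> is \<open>f\<^sup>(\<^sup>k\<^sup>)(x)\<close> applied to the \<open>k\<close> vectors in \<open>vs\<close>, by
  \<open>f\<^sup>(\<^sup>k\<^sup>+\<^sup>1\<^sup>)(x)(v, v\<^sub>1, \<dots>, v\<^sub>k) = D(y \<mapsto> f\<^sup>(\<^sup>k\<^sup>)(y)(v\<^sub>1, \<dots>, v\<^sub>k))(x)(v)\<close>.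
\<close>

primrec frechet_iter ::
    "('a::euclidean_space \<Rightarrow> 'b::euclidean_space) \<Rightarrow> 'a list \<Rightarrow> 'a \<Rightarrow> 'b" where
  "frechet_iter f [] = f"
| "frechet_iter f (v # vs) = (\<lambda>x. frechet_derivative (frechet_iter f vs) (at x) v)"

text \<open>
  Since the spaces are finite-dimensional, a map into the \<open>k\<close>-linear maps is Frechet differentiable
  iff all its evaluations are; so this says that Frechet derivatives of all orders exist (continuity
  of each derivative follows from the existence of the next one).
\<close>

definition smooth :: "('a::euclidean_space \<Rightarrow> 'b::euclidean_space) \<Rightarrow> bool" where
  "smooth f \<longleftrightarrow> (\<forall>vs x. frechet_iter f vs differentiable (at x))"

text \<open>
  The operator norm of the \<open>k\<close>-linear map \<open>f\<^sup>(\<^sup>k\<^sup>)(x)\<close>. For smooth \<open>f\<close> the set is bounded, so the real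
  supremum is the genuine one; below it is only used for smooth maps.
\<close>

definition deriv_norm ::
    "nat \<Rightarrow> ('a::euclidean_space \<Rightarrow> 'b::euclidean_space) \<Rightarrow> 'a \<Rightarrow> real" where
  "deriv_norm k f x =
    (SUP vs \<in> {vs. length vs = k \<and> (\<forall>v\<in>set vs. norm v \<le> 1)}. norm (frechet_iter f vs x))"

definition B_ge1 :: "(real^'m \<Rightarrow> real^'n) set" where
  "B_ge1 = {f. smooth f \<and> (\<forall>k\<ge>1. bdd_above (range (deriv_norm k f)))}"

definition weighted_bound ::
    "(nat \<Rightarrow> real) \<Rightarrow> real \<Rightarrow> (real^'m \<Rightarrow> real^'n) \<Rightarrow> bool" where
  "weighted_bound M \<rho> f \<longleftrightarrow>
    bdd_above {deriv_norm k f x / (\<rho> ^ k * fact k * M k) | k x. k \<ge> 1}"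

definition B_ge1_Beurling :: "(nat \<Rightarrow> real) \<Rightarrow> (real^'m \<Rightarrow> real^'n) set" where
  "B_ge1_Beurling M = {f. smooth f \<and> (\<forall>\<rho>>0. weighted_bound M \<rho> f)}"

definition B_ge1_Roumieu :: "(nat \<Rightarrow> real) \<Rightarrow> (real^'m \<Rightarrow> real^'n) set" where
  "B_ge1_Roumieu M = {f. smooth f \<and> (\<exists>\<rho>>0. weighted_bound M \<rho> f)}"

definition test_maps :: "(real^'m \<Rightarrow> real^'n) set" where
  "test_maps = {f. smooth f \<and> compact (closure {x. f x \<noteq> 0})}"

text \<open>
  For a multi-index \<open>\<alpha>\<close>, the partial derivative \<open>f\<^sup>(\<^sup>\<alpha>\<^sup>)\<close> differentiates \<open>\<alpha> i\<close> times in direction \<open>i\<close>.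
  The index type carries no order, so some order of differentiation is chosen; for smooth \<open>f\<close>
  the result does not depend on it.
\<close>

definition multi_deriv ::
    "('m::finite \<Rightarrow> nat) \<Rightarrow> (real^'m \<Rightarrow> real^'n) \<Rightarrow> real^'m \<Rightarrow> real^'n" where
  "multi_deriv \<alpha> f =
    frechet_iter f (map (\<lambda>i. axis i 1) (SOME js. \<forall>i. count_list js i = \<alpha> i))"

definition D_ge1 :: "(real^'m \<Rightarrow> real^'n) set" where
  "D_ge1 = {f. smooth f \<and> (\<forall>\<alpha>. (\<Sum>i\<in>UNIV. \<alpha> i) \<ge> 1 \<longrightarrow> multi_deriv \<alpha> f \<in> test_maps)}"

definition D_ge1_Beurling :: "(nat \<Rightarrow> real) \<Rightarrow> (real^'m \<Rightarrow> real^'n) set" where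
  "D_ge1_Beurling M = D_ge1 \<inter> B_ge1_Beurling M"

definition D_ge1_Roumieu :: "(nat \<Rightarrow> real) \<Rightarrow> (real^'m \<Rightarrow> real^'n) set" where
  "D_ge1_Roumieu M = D_ge1 \<inter> B_ge1_Roumieu M"

end

theory Submission
  imports Defs "HOL-Computational_Algebra.Formal_Power_Series"
begin

text \<open>
  Formal power series serve as majorants: \<open>A\<close> majorizes \<open>h\<close> if \<open>k! A\<^sub>k\<close> bounds the \<open>k\<close>-th derivative
  of \<open>h\<close>. Products of maps are majorized by products of series, and by the chain rule in
  coordinates \<open>f \<circ> g\<close> is majorized by \<open>F \<circ> (m G)\<close>. If \<open>F\<^sub>k = D \<sigma>\<^sup>k M\<^sub>k\<close> and \<open>G\<^sub>k = C \<rho>\<^sup>k M\<^sub>k\<close>, log-convexity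
  bounds the \<open>k\<close>-th coefficient of \<open>F \<circ> (m G)\<close> by \<open>D (\<rho> (1 + \<sigma> m C M\<^sub>1))\<^sup>k M\<^sub>k\<close>. For the Beurling
  class take \<open>\<rho>\<close> half of the required value and then \<open>\<sigma> = 1 / (m C M\<^sub>1)\<close>. Compact supports are
  preserved since the derivative of \<open>f \<circ> g\<close> vanishes wherever that of \<open>g\<close> does.
\<close>

unbundle no vec_syntax and fps_syntax

section \<open>Directional derivatives of smooth maps\<close>

text \<open>\<open>frechet_iter\<close> exposes the outermost derivative, whereas sum, product and
  chain rule rewrite the innermost one. This operator names that innermost step.\<close>

definition dir_deriv ::
    "'a::euclidean_space \<Rightarrow> ('a \<Rightarrow> 'b::euclidean_space) \<Rightarrow> 'a \<Rightarrow> 'b" where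
  "dir_deriv v h = (\<lambda>x. frechet_derivative h (at x) v)"

lemma frechet_iter_append:
  "frechet_iter h (vs @ ws) = frechet_iter (frechet_iter h ws) vs"
  by (induction vs) auto

text \<open>The last vector of the list is the direction of the first differentiation. Inductions on
  the order therefore pass from \<open>h\<close> to \<open>dir_deriv v h\<close>.\<close>

lemma frechet_iter_snoc: "frechet_iter h (vs @ [v]) = frechet_iter (dir_deriv v h) vs"
  by (simp add: frechet_iter_append dir_deriv_def)

lemma dir_deriv_eqI: "(h has_derivative h') (at x) \<Longrightarrow> dir_deriv v h x = h' v"
  unfolding dir_deriv_def by (metis frechet_derivative_at)

lemma has_derivative_dir_deriv:
  "h differentiable (at x) \<Longrightarrow> (h has_derivative (\<lambda>v. dir_deriv v h x)) (at x)"
  unfolding dir_deriv_def by (simp add: frechet_derivative_works)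

lemma dir_deriv_sum:
  assumes "\<And>i x. i \<in> I \<Longrightarrow> h i differentiable (at x)"
  shows "dir_deriv v (\<lambda>x. \<Sum>i\<in>I. h i x) = (\<lambda>x. \<Sum>i\<in>I. dir_deriv v (h i) x)"
proof
  fix x
  show "dir_deriv v (\<lambda>x. \<Sum>i\<in>I. h i x) x = (\<Sum>i\<in>I. dir_deriv v (h i) x)"
    by (rule dir_deriv_eqI) (intro has_derivative_sum has_derivative_dir_deriv assms)
qed

lemma dir_deriv_add:
  assumes "\<And>x. u differentiable (at x)" "\<And>x. h differentiable (at x)"
  shows "dir_deriv v (\<lambda>x. u x + h x) = (\<lambda>x. dir_deriv v u x + dir_deriv v h x)"
proof
  fix x
  show "dir_deriv v (\<lambda>x. u x + h x) x = dir_deriv v u x + dir_deriv v h x"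
    by (rule dir_deriv_eqI) (intro has_derivative_add has_derivative_dir_deriv assms)
qed

lemma dir_deriv_inner:
  assumes "\<And>x. h differentiable (at x)"
  shows "dir_deriv v (\<lambda>x. h x \<bullet> b) = (\<lambda>x. dir_deriv v h x \<bullet> b)"
proof
  fix x
  show "dir_deriv v (\<lambda>x. h x \<bullet> b) x = dir_deriv v h x \<bullet> b"
    by (rule dir_deriv_eqI) (intro has_derivative_inner_left has_derivative_dir_deriv assms)
qed

lemma dir_deriv_scaleR:
  assumes "\<And>x. u differentiable (at x)" "\<And>x. h differentiable (at x)"
  shows "dir_deriv v (\<lambda>x. u x *\<^sub>R h x) =
    (\<lambda>x. u x *\<^sub>R dir_deriv v h x + dir_deriv v u x *\<^sub>R h x)"
proof
  fix x
  show "dir_deriv v (\<lambda>x. u x *\<^sub>R h x) x = u x *\<^sub>R dir_deriv v h x + dir_deriv v u x *\<^sub>R h x"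
    by (rule dir_deriv_eqI) (intro has_derivative_scaleR has_derivative_dir_deriv assms)
qed

lemma dir_deriv_euclidean_expand:
  assumes "h differentiable (at x)"
  shows "dir_deriv v h x = (\<Sum>b\<in>Basis. (v \<bullet> b) *\<^sub>R dir_deriv b h x)"
proof -
  interpret linear "\<lambda>v. dir_deriv v h x"
    using has_derivative_dir_deriv[OF assms] by (rule has_derivative_linear)
  have "dir_deriv v h x = dir_deriv (\<Sum>b\<in>Basis. (v \<bullet> b) *\<^sub>R b) h x"
    by (simp add: euclidean_representation)
  also have "\<dots> = (\<Sum>b\<in>Basis. (v \<bullet> b) *\<^sub>R dir_deriv b h x)"
    by (simp add: sum scale)
  finally show ?thesis .
qed

text \<open>The derivative of \<open>f\<close> at \<open>g x\<close> is linear, so its argument is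
  expanded in the basis of the intermediate space. Each summand again contains a composition with
  the same \<open>g\<close>, which lets inductions vary \<open>f\<close> only.\<close>

lemma dir_deriv_comp:
  assumes "\<And>y. f differentiable (at y)" "\<And>x. g differentiable (at x)"
  shows "dir_deriv v (f \<circ> g) =
    (\<lambda>x. \<Sum>b\<in>Basis. (dir_deriv v g x \<bullet> b) *\<^sub>R (dir_deriv b f \<circ> g) x)"
proof
  fix x
  have "dir_deriv v (f \<circ> g) x = ((\<lambda>w. dir_deriv w f (g x)) \<circ> (\<lambda>v. dir_deriv v g x)) v"
    by (rule dir_deriv_eqI, rule diff_chain_at) (intro has_derivative_dir_deriv assms)+
  also have "\<dots> = (\<Sum>b\<in>Basis. (dir_deriv v g x \<bullet> b) *\<^sub>R dir_deriv b f (g x))"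
    unfolding comp_def by (rule dir_deriv_euclidean_expand) (rule assms)
  finally show "dir_deriv v (f \<circ> g) x =
      (\<Sum>b\<in>Basis. (dir_deriv v g x \<bullet> b) *\<^sub>R (dir_deriv b f \<circ> g) x)"
    by simp
qed

section \<open>Closure of smoothness under sums, products and composition\<close>

lemma smooth_differentiable: "smooth h \<Longrightarrow> h differentiable (at x)"
  unfolding smooth_def by (metis frechet_iter.simps(1))

lemma smooth_frechet_iter: "smooth h \<Longrightarrow> smooth (frechet_iter h ws)"
  unfolding smooth_def by (metis frechet_iter_append)

lemma smooth_dir_deriv: "smooth h \<Longrightarrow> smooth (dir_deriv v h)"
  using smooth_frechet_iter[of h "[v]"] by (simp add: dir_deriv_def)

text \<open>A graded form of smoothness that supports induction on the order. At level
  \<open>k\<close> the derivatives of order at most \<open>k\<close> are differentiable, so the map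
  is \<open>k + 1\<close> times differentiable.\<close>

primrec smooth_upto :: "nat \<Rightarrow> ('a::euclidean_space \<Rightarrow> 'b::euclidean_space) \<Rightarrow> bool" where
  "smooth_upto 0 h \<longleftrightarrow> (\<forall>x. h differentiable (at x))"
| "smooth_upto (Suc k) h \<longleftrightarrow>
    (\<forall>x. h differentiable (at x)) \<and> (\<forall>v. smooth_upto k (dir_deriv v h))"

lemma smooth_upto_frechet_iter:
  "smooth_upto (length vs) h \<Longrightarrow> frechet_iter h vs differentiable (at x)"
  by (induction vs arbitrary: h rule: rev_induct) (auto simp: frechet_iter_snoc)

lemma smooth_iff_smooth_upto: "smooth h \<longleftrightarrow> (\<forall>k. smooth_upto k h)"
proof
  assume "smooth h"
  have "smooth_upto k h" for k
    using \<open>smooth h\<close> by (induction k arbitrary: h)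
      (auto intro: smooth_differentiable smooth_dir_deriv)
  then show "\<forall>k. smooth_upto k h" ..
qed (auto simp: smooth_def intro: smooth_upto_frechet_iter)

lemma smooth_upto_SucD: "smooth_upto (Suc k) h \<Longrightarrow> smooth_upto k h"
  by (induction k arbitrary: h) auto

lemma smooth_upto_add:
  assumes "smooth_upto k u" "smooth_upto k h"
  shows "smooth_upto k (\<lambda>x. u x + h x)"
  using assms by (induction k arbitrary: u h) (auto simp: dir_deriv_add)

lemma smooth_upto_sum:
  assumes "\<And>i. i \<in> I \<Longrightarrow> smooth_upto k (h i)" "finite I"
  shows "smooth_upto k (\<lambda>x. \<Sum>i\<in>I. h i x)"
  using assms
  by (induction k arbitrary: h) (auto simp: dir_deriv_sum intro!: differentiable_sum)

lemma smooth_upto_inner: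
  assumes "smooth_upto k h"
  shows "smooth_upto k (\<lambda>x. h x \<bullet> b)"
  using assms by (induction k arbitrary: h) (auto simp: dir_deriv_inner)

lemma smooth_upto_scaleR:
  assumes "smooth_upto k u" "smooth_upto k h"
  shows "smooth_upto k (\<lambda>x. u x *\<^sub>R h x)"
  using assms
proof (induction k arbitrary: u h)
  case (Suc k)
  then have d: "u differentiable (at x)" "h differentiable (at x)" for x
    by auto
  have "smooth_upto k (dir_deriv v (\<lambda>x. u x *\<^sub>R h x))" for v
    unfolding dir_deriv_scaleR[OF d]
    \<comment> \<open>The product rule leaves one factor undifferentiated in each summand; that
      factor is lowered from level \<open>Suc k\<close> to level \<open>k\<close>.\<close>
    using Suc.prems Suc.prems[THEN smooth_upto_SucD] by (intro smooth_upto_add Suc.IH) auto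
  then show ?case
    using d by (auto intro: differentiable_scaleR)
qed (auto intro: differentiable_scaleR)

lemma smooth_inner: "smooth h \<Longrightarrow> smooth (\<lambda>x. h x \<bullet> b)"
  by (simp add: smooth_iff_smooth_upto smooth_upto_inner)

lemma smooth_scaleR: "smooth u \<Longrightarrow> smooth h \<Longrightarrow> smooth (\<lambda>x. u x *\<^sub>R h x)"
  by (simp add: smooth_iff_smooth_upto smooth_upto_scaleR)

lemma smooth_comp:
  assumes "smooth f" "smooth g"
  shows "smooth (f \<circ> g)"
proof -
  have "smooth_upto k (f \<circ> g)" for k
    using assms(1)
  proof (induction k arbitrary: f)
    case 0
    then show ?case
      using assms(2)
      unfolding smooth_upto.simps by (intro allI differentiable_chain_at smooth_differentiable)
  next
    case (Suc k)
    have d: "f differentiable (at y)" "g differentiable (at x)" for x y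
      using Suc.prems assms(2) by (auto intro: smooth_differentiable)
    have "smooth_upto k (dir_deriv v (f \<circ> g))" for v
      unfolding dir_deriv_comp[OF d]
    proof (intro smooth_upto_sum smooth_upto_scaleR smooth_upto_inner Suc.IH smooth_dir_deriv)
      show "smooth_upto k (dir_deriv v g)"
        using assms(2) smooth_dir_deriv smooth_iff_smooth_upto by blast
    qed (use Suc.prems in auto)
    then show ?case
      unfolding smooth_upto.simps by (intro allI conjI differentiable_chain_at d) auto
  qed
  then show ?thesis
    by (simp add: smooth_iff_smooth_upto)
qed

section \<open>Majorants\<close>

text \<open>The order \<open>k\<close> is the induction parameter. The point \<open>x\<close> is
  fixed because a composition needs bounds for \<open>f\<close> at \<open>g x\<close> and for
  \<open>g\<close> at \<open>x\<close>.\<close>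

definition majorizes ::
    "real fps \<Rightarrow> nat \<Rightarrow> 'a \<Rightarrow> ('a::euclidean_space \<Rightarrow> 'b::euclidean_space) \<Rightarrow> bool" where
  "majorizes A k x h \<longleftrightarrow> (\<forall>vs. length vs \<le> k \<and> (\<forall>v\<in>set vs. norm v \<le> 1) \<longrightarrow>
     norm (frechet_iter h vs x) \<le> fact (length vs) * A $ length vs)"

lemma majorizes_0: "majorizes A 0 x h \<longleftrightarrow> norm (h x) \<le> A $ 0"
  by (simp add: majorizes_def)

lemma majorizes_mono: "majorizes A k x h \<Longrightarrow> j \<le> k \<Longrightarrow> majorizes A j x h"
  unfolding majorizes_def by auto

text \<open>Thanks to the factorial normalization, differentiating a map corresponds to the formal
  derivative of its majorant.\<close>

lemma fact_Suc_mult_fps_nth: "fact (Suc k) * A $ Suc k = fact k * fps_deriv A $ k"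
  for A :: "real fps"
  by (simp add: algebra_simps)

text \<open>Splitting off the last vector of the list gives a recursion in the order, on which the
  inductions for sums, products and compositions rest.\<close>

lemma majorizes_Suc:
  "majorizes A (Suc k) x h \<longleftrightarrow>
    norm (h x) \<le> A $ 0 \<and> (\<forall>v. norm v \<le> 1 \<longrightarrow> majorizes (fps_deriv A) k x (dir_deriv v h))"
proof
  assume L: "majorizes A (Suc k) x h"
  show "norm (h x) \<le> A $ 0 \<and> (\<forall>v. norm v \<le> 1 \<longrightarrow> majorizes (fps_deriv A) k x (dir_deriv v h))"
  proof (intro conjI allI impI)
    show "norm (h x) \<le> A $ 0"
      using L unfolding majorizes_def by (auto dest: spec[of _ "[]"])
    fix v :: 'a assume v: "norm v \<le> 1"
    show "majorizes (fps_deriv A) k x (dir_deriv v h)"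
      unfolding majorizes_def
    proof (intro allI impI)
      fix vs :: "'a list" assume vs: "length vs \<le> k \<and> (\<forall>v\<in>set vs. norm v \<le> 1)"
      have "norm (frechet_iter h (vs @ [v]) x) \<le> fact (length (vs @ [v])) * A $ length (vs @ [v])"
        using L v vs unfolding majorizes_def by (intro L[unfolded majorizes_def, rule_format]) auto
      then show "norm (frechet_iter (dir_deriv v h) vs x) \<le>
          fact (length vs) * fps_deriv A $ length vs"
        unfolding frechet_iter_snoc by (simp only: length_append_singleton fact_Suc_mult_fps_nth)
    qed
  qed
next
  assume R: "norm (h x) \<le> A $ 0 \<and>
    (\<forall>v. norm v \<le> 1 \<longrightarrow> majorizes (fps_deriv A) k x (dir_deriv v h))"
  show "majorizes A (Suc k) x h"
    unfolding majorizes_def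
  proof (intro allI impI)
    fix us :: "'a list" assume us: "length us \<le> Suc k \<and> (\<forall>v\<in>set us. norm v \<le> 1)"
    show "norm (frechet_iter h us x) \<le> fact (length us) * A $ length us"
    proof (cases us rule: rev_cases)
      case (snoc vs v)
      then have "norm (frechet_iter (dir_deriv v h) vs x) \<le> fact (length vs) * fps_deriv A $ length vs"
        using R us by (auto simp: majorizes_def simp del: fps_deriv_nth)
      then show ?thesis
        unfolding snoc frechet_iter_snoc by (simp only: length_append_singleton fact_Suc_mult_fps_nth)
    qed (use R in auto)
  qed
qed

lemma majorizes_add:
  assumes "smooth u" "smooth h" "majorizes A k x u" "majorizes B k x h"
  shows "majorizes (A + B) k x (\<lambda>x. u x + h x)"
  using assms
proof (induction k arbitrary: u h A B)
  case 0
  then show ?case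
    by (auto simp: majorizes_0 intro: norm_triangle_mono)
next
  case (Suc k)
  have "majorizes (fps_deriv A + fps_deriv B) k x (\<lambda>x. dir_deriv v u x + dir_deriv v h x)"
    if "norm v \<le> 1" for v
    using that Suc.prems by (intro Suc.IH smooth_dir_deriv) (auto simp: majorizes_Suc)
  then show ?case
    using Suc.prems
    by (auto simp: majorizes_Suc dir_deriv_add smooth_differentiable intro: norm_triangle_mono)
qed

lemma majorizes_sum:
  assumes "\<And>i. i \<in> I \<Longrightarrow> smooth (h i)" "\<And>i. i \<in> I \<Longrightarrow> majorizes (A i) k x (h i)"
  shows "majorizes (\<Sum>i\<in>I. A i) k x (\<lambda>x. \<Sum>i\<in>I. h i x)"
  using assms
proof (induction k arbitrary: h A)
  case 0
  then show ?case
    by (auto simp: majorizes_0 fps_sum_nth intro: sum_norm_le)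
next
  case (Suc k)
  have "majorizes (\<Sum>i\<in>I. fps_deriv (A i)) k x (\<lambda>x. \<Sum>i\<in>I. dir_deriv v (h i) x)"
    if "norm v \<le> 1" for v
    using that Suc.prems by (intro Suc.IH smooth_dir_deriv) (auto simp: majorizes_Suc)
  then show ?case
    using Suc.prems
    by (auto simp: majorizes_Suc dir_deriv_sum smooth_differentiable fps_sum_nth fps_deriv_sum
        intro: sum_norm_le)
qed

lemma majorizes_inner:
  assumes "smooth h" "majorizes A k x h" "norm b \<le> 1"
  shows "majorizes A k x (\<lambda>x. h x \<bullet> b)"
proof -
  have le: "norm (y \<bullet> b) \<le> norm y" for y :: 'b
    using Cauchy_Schwarz_ineq2[of y b] mult_left_mono[OF assms(3), of "norm y"] by simp
  show ?thesis
    using assms(1,2)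
  proof (induction k arbitrary: h A)
    case 0
    then show ?case
      using le[of "h x"] by (auto simp: majorizes_0)
  next
    case (Suc k)
    then show ?case
      using le[of "h x"]
      by (auto simp: majorizes_Suc dir_deriv_inner smooth_differentiable smooth_dir_deriv)
  qed
qed

lemma majorizes_scaleR:
  assumes "smooth u" "smooth h" "majorizes A k x u" "majorizes B k x h"
  shows "majorizes (A * B) k x (\<lambda>x. u x *\<^sub>R h x)"
  using assms
proof (induction k arbitrary: u h A B)
  case 0
  then show ?case
    by (auto simp: majorizes_0 intro!: mult_mono')
next
  case (Suc k)
  have d: "u differentiable (at y)" "h differentiable (at y)" for y
    using Suc.prems by (auto intro: smooth_differentiable)
  note maj = Suc.prems(3,4)[unfolded majorizes_Suc]
  have k: "majorizes A k x u" "majorizes B k x h"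
    using Suc.prems(3,4) by (auto elim: majorizes_mono)
  have "norm (u x *\<^sub>R h x) \<le> (A * B) $ 0"
    using maj by (auto intro!: mult_mono')
  moreover have "majorizes (fps_deriv (A * B)) k x (dir_deriv v (\<lambda>x. u x *\<^sub>R h x))"
    if "norm v \<le> 1" for v
    \<comment> \<open>Both product rules have the same shape, so the two summands can be majorized
      separately; \<open>k\<close> supplies the bounds for the undifferentiated factors.\<close>
    unfolding dir_deriv_scaleR[OF d] fps_deriv_mult
    using that maj k Suc.prems(1,2)
    by (intro majorizes_add Suc.IH smooth_scaleR smooth_dir_deriv) auto
  ultimately show ?case
    by (auto simp: majorizes_Suc)
qed

text \<open>
  The factor \<open>DIM('b)\<close> comes from expanding the chain rule in coordinates. It only rescales the
  constants later, so no sharp form of the Faa di Bruno formula is needed.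
\<close>

lemma majorizes_dir_deriv_comp:
  fixes f :: "'b::euclidean_space \<Rightarrow> 'c::euclidean_space" and g :: "'a::euclidean_space \<Rightarrow> 'b"
  assumes "smooth f" "smooth g" "majorizes G k x (dir_deriv v g)"
    and "\<And>b. b \<in> Basis \<Longrightarrow> majorizes A k x (dir_deriv b f \<circ> g)"
  shows "majorizes (A * (of_nat DIM('b) * G)) k x (dir_deriv v (f \<circ> g))"
proof -
  have d: "f differentiable (at y)" "g differentiable (at x)" for x y
    using assms by (auto intro: smooth_differentiable)
  have "majorizes (\<Sum>b\<in>(Basis :: 'b set). G * A) k x (dir_deriv v (f \<circ> g))"
    unfolding dir_deriv_comp[OF d]
    using assms
    by (intro majorizes_sum majorizes_scaleR majorizes_inner smooth_scaleR smooth_inner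
        smooth_dir_deriv smooth_comp) (auto simp: comp_def)
  also have "(\<Sum>b\<in>(Basis :: 'b set). G * A) = A * (of_nat DIM('b) * G)"
    by (simp add: algebra_simps)
  finally show ?thesis .
qed

text \<open>The chain rule for \<open>f \<circ> g\<close> mirrors the one for formal composition,
  which requires the zero constant term of \<open>G\<close>. Only derivatives of \<open>g\<close>
  are bounded: its value enters solely as the point where \<open>f\<close> is majorized.\<close>

lemma majorizes_comp:
  fixes f :: "'b::euclidean_space \<Rightarrow> 'c::euclidean_space" and g :: "'a::euclidean_space \<Rightarrow> 'b"
  assumes "smooth f" "smooth g" "G $ 0 = 0"
    and "majorizes A k (g x) f"
    and "\<And>v. norm v \<le> 1 \<Longrightarrow> majorizes (fps_deriv G) k x (dir_deriv v g)"
  shows "majorizes (A oo (of_nat DIM('b) * G)) k x (f \<circ> g)"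
  using assms(1,4,5)
proof (induction k arbitrary: f A)
  case 0
  then show ?case
    by (simp add: majorizes_0)
next
  case (Suc k)
  have G: "majorizes (fps_deriv G) k x (dir_deriv v g)" if "norm v \<le> 1" for v
    using Suc.prems(3)[OF that] by (rule majorizes_mono) simp
  have "fps_deriv (A oo (of_nat DIM('b) * G)) =
      (fps_deriv A oo (of_nat DIM('b) * G)) * (of_nat DIM('b) * fps_deriv G)"
    using assms(3) by (simp add: fps_compose_deriv)
  moreover have "majorizes (fps_deriv A oo (of_nat DIM('b) * G)) k x (dir_deriv b f \<circ> g)"
    if "b \<in> Basis" for b
    using that Suc.prems G
    by (intro Suc.IH smooth_dir_deriv) (auto simp: majorizes_Suc)
  ultimately have "majorizes (fps_deriv (A oo (of_nat DIM('b) * G))) k x (dir_deriv v (f \<circ> g))"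
    if "norm v \<le> 1" for v
    using majorizes_dir_deriv_comp[OF Suc.prems(1) assms(2) G[OF that]] by metis
  then show ?case
    using Suc.prems(2) by (simp add: majorizes_Suc comp_def)
qed

section \<open>Existence of majorants for arbitrary smooth maps\<close>

lemma dir_deriv_const: "dir_deriv v (\<lambda>x. c) = (\<lambda>x. 0)"
  by (auto simp: dir_deriv_def)

lemma smooth_const: "smooth (\<lambda>x::'a::euclidean_space. c::'b::euclidean_space)"
proof -
  have "smooth_upto k (\<lambda>x::'a. c)" for k
    by (induction k arbitrary: c) (auto simp: dir_deriv_const)
  then show ?thesis
    by (simp add: smooth_iff_smooth_upto)
qed

lemma majorizes_const: "norm c \<le> a \<Longrightarrow> majorizes (fps_const a) k x (\<lambda>y. c)"
proof (induction k arbitrary: a c)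
  case (Suc k)
  then show ?case
    using Suc.IH[of 0 0] by (simp add: majorizes_Suc dir_deriv_const)
qed (simp add: majorizes_0)

text \<open>Finitely many basis directions control all directions in the unit ball, since the
  coordinates there are at most 1 in absolute value. This provides the finiteness of the supremum in
  \<open>deriv_norm\<close>.\<close>

lemma ex_majorant:
  assumes "smooth h"
  shows "\<exists>A. majorizes A k x h"
  using assms
proof (induction k arbitrary: h)
  case 0
  have "majorizes (fps_const (norm (h x))) 0 x h"
    by (simp add: majorizes_0)
  then show ?case ..
next
  case (Suc k)
  have "\<exists>A. majorizes A k x (dir_deriv b h)" for b
    by (intro Suc.IH smooth_dir_deriv Suc.prems)
  then obtain A where A: "\<And>b. majorizes (A b) k x (dir_deriv b h)"
    by metis
  \<comment> \<open>The factor \<open>fps_const 1\<close> majorizes the constant coordinate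
    functions \<open>v \<bullet> b\<close>.\<close>
  define B where "B = (\<Sum>b\<in>Basis. fps_const 1 * A b)"
  have "majorizes B k x (dir_deriv v h)" if "norm v \<le> 1" for v
  proof -
    have "dir_deriv v h = (\<lambda>x. \<Sum>b\<in>Basis. (v \<bullet> b) *\<^sub>R dir_deriv b h x)"
      using Suc.prems by (auto intro!: dir_deriv_euclidean_expand smooth_differentiable)
    moreover have "\<bar>v \<bullet> b\<bar> \<le> 1" if "b \<in> Basis" for b
      using Basis_le_norm[OF that, of v] \<open>norm v \<le> 1\<close> by simp
    ultimately show ?thesis
      unfolding B_def using A Suc.prems
      by (simp only:, intro majorizes_sum majorizes_scaleR smooth_scaleR smooth_dir_deriv
          smooth_const majorizes_const) auto
  qed
  moreover have "fps_deriv (fps_integral B (norm (h x))) = B" 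
    by (rule fps_deriv_fps_integral)
  ultimately have "majorizes (fps_integral B (norm (h x))) (Suc k) x h"
    by (simp add: majorizes_Suc)
  then show ?case ..
qed

lemma majorizes_le: "majorizes A k x h \<Longrightarrow> (\<And>j. A $ j \<le> B $ j) \<Longrightarrow> majorizes B k x h"
  unfolding majorizes_def by (meson fact_ge_zero mult_left_mono order_trans)

section \<open>Log-convex weight sequences\<close>

text \<open>Log-convexity says that the quotients \<open>M (Suc k) / M k\<close> increase with
  \<open>k\<close>; the inequality is cleared of denominators.\<close>

lemma log_convex_ratio_mono:
  assumes "weight_sequence M" "log_convex M" "i \<le> j"
  shows "M (Suc i) * M j \<le> M i * M (Suc j)"
  using assms(3)
proof (induction j rule: dec_induct)
  case (step j)
  have pos: "M k > 0" for k
    using assms(1) by (simp add: weight_sequence_def)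
  have "M j * (M (Suc i) * M (Suc j)) \<le> M i * (M (Suc j))\<^sup>2"
    using mult_right_mono[OF step.IH, of "M (Suc j)"] pos[of "Suc j"]
    by (simp add: power2_eq_square algebra_simps)
  also have "(M (Suc j))\<^sup>2 \<le> M j * M (Suc (Suc j))"
    using assms(2)[unfolded log_convex_def, rule_format, of "Suc j"] by simp
  finally have "M j * (M (Suc i) * M (Suc j)) \<le> M j * (M i * M (Suc (Suc j)))"
    using pos[of i] by (simp add: algebra_simps)
  then show ?case
    using pos[of j] by simp
qed simp

text \<open>In quotient form: \<open>(M (Suc j) / M j) * M s * M r \<le> M 1 * M (r + s)\<close>.
  For \<open>s = 1\<close> this compares the quotients at \<open>j\<close> and \<open>r\<close>;
  each further step in \<open>s\<close> compares those at \<open>s\<close> and \<open>r + s\<close>.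
  It is the cost of one more factor in a power of a weight series.\<close>

lemma log_convex_mult_le:
  assumes "weight_sequence M" "log_convex M" "j \<le> r" "1 \<le> s"
  shows "M (Suc j) * M s * M r \<le> M 1 * M j * M (r + s)"
  using assms(4)
proof (induction s rule: dec_induct)
  case base
  show ?case
    using mult_left_mono[OF log_convex_ratio_mono[OF assms(1-3)], of "M 1"] assms(1)
    by (simp add: weight_sequence_def algebra_simps)
next
  case (step s)
  have pos: "M k > 0" for k
    using assms(1) by (simp add: weight_sequence_def)
  have "M (r + s) * (M (Suc j) * M (Suc s) * M r) = (M (Suc s) * M (r + s)) * (M (Suc j) * M r)"
    by simp
  also have "\<dots> \<le> (M s * M (Suc (r + s))) * (M (Suc j) * M r)"
    using log_convex_ratio_mono[OF assms(1,2), of s "r + s"] pos[of "Suc j"] pos[of r]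
    by (intro mult_right_mono) auto
  also have "\<dots> = (M (Suc j) * M s * M r) * M (Suc (r + s))"
    by simp
  also have "\<dots> \<le> (M 1 * M j * M (r + s)) * M (Suc (r + s))"
    using pos by (intro mult_right_mono step.IH) (simp add: less_imp_le)
  finally have "M (r + s) * (M (Suc j) * M (Suc s) * M r) \<le>
      M (r + s) * (M 1 * M j * M (r + Suc s))"
    by (simp add: algebra_simps)
  then show ?case
    using pos[of "r + s"] by simp
qed

text \<open>The constant term is 0 because the values of the maps themselves are not controlled.\<close>

definition weight_fps :: "(nat \<Rightarrow> real) \<Rightarrow> real \<Rightarrow> real \<Rightarrow> real fps" where
  "weight_fps M C \<rho> = Abs_fps (\<lambda>k. if k = 0 then 0 else C * \<rho> ^ k * M k)"

lemma weight_fps_nth: "weight_fps M C \<rho> $ k = (if k = 0 then 0 else C * \<rho> ^ k * M k)"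
  by (simp add: weight_fps_def)

lemma of_nat_mult_weight_fps: "of_nat m * weight_fps M C \<rho> = weight_fps M (of_nat m * C) \<rho>"
  by (rule fps_ext) (simp add: weight_fps_nth flip: fps_of_nat)

text \<open>Each factor of the power contributes \<open>C * M 1\<close>. For positive
  \<open>j\<close> and \<open>k\<close> the number of compositions of \<open>k\<close> into
  \<open>j\<close> positive parts is \<open>(k - 1) choose (j - 1)\<close>; the larger
  \<open>k choose j\<close> is used because it later sums to a binomial expansion.\<close>

lemma weight_fps_power_le:
  assumes "weight_sequence M" "log_convex M" "0 \<le> C" "0 \<le> \<rho>"
  shows "M j * (weight_fps M C \<rho> ^ j) $ k \<le> (C * M 1) ^ j * \<rho> ^ k * M k * (k choose j)"
proof (induction j arbitrary: k)
  case 0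
  show ?case
    using assms by (cases k) (auto simp: weight_sequence_def less_imp_le)
next
  case (Suc j)
  let ?G = "weight_fps M C \<rho>"
  define K where "K = (C * M 1) ^ Suc j * \<rho> ^ k * M k"
  have pos: "M k > 0" for k
    using assms(1) by (simp add: weight_sequence_def)
  have term_le: "M (Suc j) * ((?G ^ j) $ i * ?G $ (k - i)) \<le> K * (i choose j)" if "i < k" for i
  proof -
    define s where "s = k - i"
    have k: "k = i + s" and s: "1 \<le> s"
      using that by (auto simp: s_def)
    \<comment> \<open>The extra factor \<open>M j\<close> makes the induction hypothesis applicable
      while \<open>M (Suc j)\<close> remains for the log-convexity estimate; it is cancelled at the
      end.\<close>
    have "M j * (M (Suc j) * ((?G ^ j) $ i * ?G $ s)) =
        (M j * (?G ^ j) $ i) * (M (Suc j) * (C * \<rho> ^ s * M s))"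
      using s by (simp add: weight_fps_nth)
    also have "\<dots> \<le> ((C * M 1) ^ j * \<rho> ^ i * M i * (i choose j)) * (M (Suc j) * (C * \<rho> ^ s * M s))"
      using pos assms(3,4) by (intro mult_right_mono Suc.IH) (simp add: less_imp_le)
    also have "\<dots> = ((C * M 1) ^ j * C * \<rho> ^ k) * ((i choose j) * (M (Suc j) * M s * M i))"
      by (simp add: k power_add algebra_simps)
    also have "\<dots> \<le> ((C * M 1) ^ j * C * \<rho> ^ k) * ((i choose j) * (M 1 * M j * M k))"
    \<comment> \<open>The log-convexity estimate requires \<open>j \<le> i\<close>; otherwise the
      binomial coefficient makes both sides 0.\<close>
    proof (cases "j \<le> i")
      case True
      then show ?thesis
        using log_convex_mult_le[OF assms(1,2) True s] pos[of 1] assms(3,4)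
        unfolding k by (intro mult_left_mono) auto
    qed (simp add: binomial_eq_0)
    also have "\<dots> = M j * (K * (i choose j))"
      by (simp add: K_def algebra_simps)
    finally show ?thesis
      using pos[of j] unfolding s_def[symmetric] by simp
  qed
  have "M (Suc j) * (?G ^ Suc j) $ k = (\<Sum>i=0..k. M (Suc j) * ((?G ^ j) $ i * ?G $ (k - i)))"
    by (simp only: power_Suc2 fps_mult_nth sum_distrib_left)
  \<comment> \<open>The term \<open>i = k\<close> vanishes because the last factor has constant term
    0.\<close>
  also have "\<dots> = (\<Sum>i<k. M (Suc j) * ((?G ^ j) $ i * ?G $ (k - i)))"
    by (simp add: atLeast0AtMost lessThan_Suc_atMost[symmetric] weight_fps_nth)
  also have "\<dots> \<le> (\<Sum>i<k. K * (i choose j))"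
    by (intro sum_mono term_le) auto
  also have "\<dots> = K * (k choose Suc j)"
  proof -
    \<comment> \<open>The hockey-stick identity.\<close>
    have "(\<Sum>i<k. i choose j) = k choose Suc j"
      by (cases k) (simp_all add: lessThan_Suc_atMost sum_choose_upper del: binomial_Suc_Suc)
    then show ?thesis
      by (simp flip: sum_distrib_left of_nat_sum)
  qed
  finally show ?case
    by (simp add: K_def)
qed

text \<open>After the power estimate, the sum over \<open>j\<close> is the binomial expansion of
  \<open>(\<sigma> * C * M 1 + 1) ^ k\<close>.\<close>

lemma weight_fps_compose_le:
  assumes "weight_sequence M" "log_convex M" "0 \<le> C" "0 \<le> \<rho>" "0 \<le> D" "0 \<le> \<sigma>"
  shows "(weight_fps M D \<sigma> oo weight_fps M C \<rho>) $ k \<le> D * (\<rho> * (1 + \<sigma> * C * M 1)) ^ k * M k"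
proof -
  let ?G = "weight_fps M C \<rho>"
  have pos: "M k > 0" for k
    using assms(1) by (simp add: weight_sequence_def)
  have "(weight_fps M D \<sigma> oo ?G) $ k = (\<Sum>j=0..k. weight_fps M D \<sigma> $ j * (?G ^ j) $ k)"
    by (rule fps_compose_nth)
  also have "\<dots> \<le> (\<Sum>j=0..k. D * \<rho> ^ k * M k * ((k choose j) * (\<sigma> * C * M 1) ^ j))"
  proof (rule sum_mono)
    fix j
    have "D * \<sigma> ^ j * (M j * (?G ^ j) $ k) \<le>
        D * \<sigma> ^ j * ((C * M 1) ^ j * \<rho> ^ k * M k * (k choose j))"
      using assms by (intro mult_left_mono weight_fps_power_le) auto
    \<comment> \<open>Covers \<open>j = 0\<close>, where the outer coefficient is 0 but the binomial
      sum has a nonnegative term.\<close>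
    moreover have "0 \<le> D * \<rho> ^ k * M k * ((k choose j) * (\<sigma> * C * M 1) ^ j)"
      using assms pos[of 1] pos[of k] by simp
    ultimately show "weight_fps M D \<sigma> $ j * (?G ^ j) $ k \<le>
        D * \<rho> ^ k * M k * ((k choose j) * (\<sigma> * C * M 1) ^ j)"
      by (cases "j = 0") (simp_all add: weight_fps_nth power_mult_distrib algebra_simps)
  qed
  also have "\<dots> = D * \<rho> ^ k * M k * (\<sigma> * C * M 1 + 1) ^ k"
    by (simp add: binomial_ring atLeast0AtMost sum_distrib_left)
  finally show ?thesis
    by (simp add: power_mult_distrib ac_simps)
qed

section \<open>Weighted bounds as majorants\<close>

text \<open>A real supremum is an upper bound only for a bounded set; boundedness comes from a
  majorant at \<open>x\<close>.\<close>

lemma norm_frechet_iter_le_deriv_norm: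
  assumes "smooth h" "\<forall>v\<in>set vs. norm v \<le> 1"
  shows "norm (frechet_iter h vs x) \<le> deriv_norm (length vs) h x"
proof -
  obtain A where "majorizes A (length vs) x h"
    using ex_majorant[OF assms(1)] by blast
  then have "bdd_above ((\<lambda>vs. norm (frechet_iter h vs x)) `
      {us. length us = length vs \<and> (\<forall>v\<in>set us. norm v \<le> 1)})"
    unfolding majorizes_def
    by (auto intro!: bdd_aboveI2[of _ _ "fact (length vs) * A $ length vs"]) (metis order_refl)
  then show ?thesis
    unfolding deriv_norm_def using assms(2) by (intro cSUP_upper) auto
qed

lemma deriv_norm_le:
  assumes "\<And>vs. length vs = k \<Longrightarrow> \<forall>v\<in>set vs. norm v \<le> 1 \<Longrightarrow> norm (frechet_iter h vs x) \<le> c"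
  shows "deriv_norm k h x \<le> c"
  unfolding deriv_norm_def
proof (rule cSUP_least)
  have "replicate k 0 \<in> {vs. length vs = k \<and> (\<forall>v\<in>set vs. norm v \<le> 1)}"
    by auto
  then show "{vs. length vs = k \<and> (\<forall>v\<in>set vs. norm v \<le> 1)} \<noteq> {}"
    by blast
qed (use assms in auto)

text \<open>Weighted bounds start at order 1, so they are expressed by majorants of the first
  directional derivatives, with one constant for all points, orders and unit-ball
  directions.\<close>

lemma weighted_bound_iff_majorizes:
  assumes "weight_sequence M" "0 < \<rho>" "smooth h"
  shows "weighted_bound M \<rho> h \<longleftrightarrow>
    (\<exists>C>0. \<forall>v x k. norm v \<le> 1 \<longrightarrow> majorizes (fps_deriv (weight_fps M C \<rho>)) k x (dir_deriv v h))"
    (is "_ \<longleftrightarrow> ?R")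
proof
  have pos: "0 < \<rho> ^ k * fact k * M k" for k
    using assms(1,2) by (simp add: weight_sequence_def)
  {
    assume "weighted_bound M \<rho> h"
    then obtain C0 where C0: "\<And>k x. 1 \<le> k \<Longrightarrow> deriv_norm k h x / (\<rho> ^ k * fact k * M k) \<le> C0"
      unfolding weighted_bound_def bdd_above_def by blast
    \<comment> \<open>The maximum makes the constant positive.\<close>
    define C where "C = max C0 1"
    have C: "deriv_norm k h x \<le> fact k * (C * \<rho> ^ k * M k)" if "1 \<le> k" for k x
    proof -
      have "deriv_norm k h x / (\<rho> ^ k * fact k * M k) \<le> C"
        using C0[OF that, of x] by (simp add: C_def)
      then show ?thesis
        using pos[of k] by (simp add: pos_divide_le_eq algebra_simps)
    qed
    have "majorizes (fps_deriv (weight_fps M C \<rho>)) k x (dir_deriv v h)" if "norm v \<le> 1" for v x k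
      unfolding majorizes_def
    proof (intro allI impI)
      fix vs :: "(real^'a) list" assume vs: "length vs \<le> k \<and> (\<forall>v\<in>set vs. norm v \<le> 1)"
      have "norm (frechet_iter h (vs @ [v]) x) \<le> deriv_norm (length (vs @ [v])) h x"
        using vs that by (intro norm_frechet_iter_le_deriv_norm assms) auto
      also have "\<dots> \<le> fact (length (vs @ [v])) * weight_fps M C \<rho> $ length (vs @ [v])"
        using C[of "length (vs @ [v])" x] by (simp add: weight_fps_nth)
      finally show "norm (frechet_iter (dir_deriv v h) vs x) \<le>
          fact (length vs) * fps_deriv (weight_fps M C \<rho>) $ length vs"
        unfolding frechet_iter_snoc by (simp only: length_append_singleton fact_Suc_mult_fps_nth)
    qed
    then show ?R
      by (intro exI[of _ C]) (auto simp: C_def)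
  }
  {
    assume ?R
    then obtain C where C: "\<And>v x k. norm v \<le> 1 \<Longrightarrow>
        majorizes (fps_deriv (weight_fps M C \<rho>)) k x (dir_deriv v h)"
      by blast
    have "deriv_norm k h x / (\<rho> ^ k * fact k * M k) \<le> C" if "1 \<le> k" for k x
    proof -
      have "deriv_norm k h x \<le> fact k * weight_fps M C \<rho> $ k"
      proof (rule deriv_norm_le)
        fix us :: "(real^'a) list" assume us: "length us = k" "\<forall>v\<in>set us. norm v \<le> 1"
        then obtain vs v where [simp]: "us = vs @ [v]"
          using \<open>1 \<le> k\<close> by (cases us rule: rev_cases) auto
        have "norm (frechet_iter (dir_deriv v h) vs x) \<le>
            fact (length vs) * fps_deriv (weight_fps M C \<rho>) $ length vs"
          using us C[of v "length vs" x] unfolding majorizes_def by auto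
        then show "norm (frechet_iter h us x) \<le> fact k * weight_fps M C \<rho> $ k"
          unfolding us(1)[symmetric] \<open>us = vs @ [v]\<close> frechet_iter_snoc
          by (simp only: length_append_singleton fact_Suc_mult_fps_nth)
      qed
      then show ?thesis
        using pos[of k] that by (simp add: pos_divide_le_eq weight_fps_nth algebra_simps)
    qed
    then show "weighted_bound M \<rho> h"
      unfolding weighted_bound_def bdd_above_def by blast
  }
qed

section \<open>Composition in the weighted classes\<close>

text \<open>The constant \<open>C\<close> for \<open>g\<close> is explicit because in the Beurling
  case \<open>\<sigma>\<close> is chosen in terms of it. The dimension factor is absorbed into
  \<open>C\<close>.\<close>

lemma weighted_bound_comp:
  fixes f :: "real^'m \<Rightarrow> real^'n" and g :: "real^'l \<Rightarrow> real^'m"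
  assumes M: "weight_sequence M" "log_convex M"
    and "smooth f" "smooth g" "0 < \<rho>" "0 < C" "0 < \<sigma>"
    and g: "\<And>v x k. norm v \<le> 1 \<Longrightarrow>
      majorizes (fps_deriv (weight_fps M C \<rho>)) k x (dir_deriv v g)"
    and f: "weighted_bound M \<sigma> f"
  shows "weighted_bound M (\<rho> * (1 + \<sigma> * (of_nat DIM(real^'m) * C) * M 1)) (f \<circ> g)"
proof -
  let ?m = "of_nat DIM(real^'m)"
  define \<tau> where "\<tau> = \<rho> * (1 + \<sigma> * (?m * C) * M 1)"
  have "0 < M 1"
    using M(1) by (simp add: weight_sequence_def)
  then have "0 < \<tau>"
    unfolding \<tau>_def using assms(5-7) by (intro mult_pos_pos add_pos_nonneg) auto
  obtain D where D: "0 < D" "\<And>v x k. norm v \<le> 1 \<Longrightarrow>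
      majorizes (fps_deriv (weight_fps M D \<sigma>)) k x (dir_deriv v f)"
    using f weighted_bound_iff_majorizes[OF M(1) \<open>0 < \<sigma>\<close> \<open>smooth f\<close>] by blast
  let ?F = "weight_fps M D \<sigma>" and ?G = "weight_fps M C \<rho>"
  have le: "(?F oo (?m * ?G)) $ k \<le> weight_fps M D \<tau> $ k" for k
    using weight_fps_compose_le[OF M, of "?m * C" \<rho> D \<sigma> k] assms(5-7) D(1)
    by (simp add: of_nat_mult_weight_fps weight_fps_nth \<tau>_def)
  have "majorizes (fps_deriv (weight_fps M D \<tau>)) k x (dir_deriv v (f \<circ> g))"
    if "norm v \<le> 1" for v x k
  proof (rule majorizes_le)
    \<comment> \<open>The composition lemma is applied to the partial derivatives of
      \<open>f\<close>, since the values of \<open>f\<close> have no uniform bound. The product is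
      the formal derivative of \<open>?F oo (?m * ?G)\<close>.\<close>
    have "majorizes ((fps_deriv ?F oo (?m * ?G)) * (?m * fps_deriv ?G)) k x (dir_deriv v (f \<circ> g))"
      using that assms(3,4) g D(2)
      by (intro majorizes_dir_deriv_comp majorizes_comp smooth_dir_deriv)
        (auto simp: weight_fps_nth)
    then show "majorizes (fps_deriv (?F oo (?m * ?G))) k x (dir_deriv v (f \<circ> g))"
      by (simp add: fps_compose_deriv weight_fps_nth)
  next
    fix j
    show "fps_deriv (?F oo (?m * ?G)) $ j \<le> fps_deriv (weight_fps M D \<tau>) $ j"
      using le[of "Suc j"] by (simp add: mult_left_mono)
  qed
  then show ?thesis
    using D(1) weighted_bound_iff_majorizes[OF M(1) \<open>0 < \<tau>\<close> smooth_comp[OF assms(3,4)]]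
    unfolding \<tau>_def by blast
qed

lemma B_ge1_Roumieu_comp:
  fixes f :: "real^'m \<Rightarrow> real^'n" and g :: "real^'l \<Rightarrow> real^'m"
  assumes M: "weight_sequence M" "log_convex M"
    and f: "f \<in> B_ge1_Roumieu M" and g: "g \<in> B_ge1_Roumieu M"
  shows "f \<circ> g \<in> B_ge1_Roumieu M"
proof -
  obtain \<rho> \<sigma> where \<rho>: "0 < \<rho>" "weighted_bound M \<rho> g" and \<sigma>: "0 < \<sigma>" "weighted_bound M \<sigma> f"
    and smooth: "smooth f" "smooth g"
    using f g by (auto simp: B_ge1_Roumieu_def)
  obtain C where C: "0 < C" "\<And>v x k. norm v \<le> 1 \<Longrightarrow>
      majorizes (fps_deriv (weight_fps M C \<rho>)) k x (dir_deriv v g)"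
    using \<rho>(2) weighted_bound_iff_majorizes[OF M(1) \<rho>(1) smooth(2)] by blast
  have "0 < M 1"
    using M(1) by (simp add: weight_sequence_def)
  then have "0 < \<rho> * (1 + \<sigma> * (of_nat DIM(real^'m) * C) * M 1)"
    using \<rho>(1) \<sigma>(1) C(1) by (intro mult_pos_pos add_pos_nonneg) auto
  then show ?thesis
    using weighted_bound_comp[OF M smooth \<rho>(1) C(1) \<sigma>(1) C(2) \<sigma>(2)] smooth_comp[OF smooth]
    by (auto simp: B_ge1_Roumieu_def)
qed

lemma B_ge1_Beurling_comp:
  fixes f :: "real^'m \<Rightarrow> real^'n" and g :: "real^'l \<Rightarrow> real^'m"
  assumes M: "weight_sequence M" "log_convex M"
    and f: "f \<in> B_ge1_Beurling M" and g: "g \<in> B_ge1_Beurling M"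
  shows "f \<circ> g \<in> B_ge1_Beurling M"
proof -
  have smooth: "smooth f" "smooth g"
    using f g by (auto simp: B_ge1_Beurling_def)
  have "weighted_bound M \<rho> (f \<circ> g)" if "0 < \<rho>" for \<rho>
  proof -
    have half: "0 < \<rho> / 2" "weighted_bound M (\<rho> / 2) g"
      using that g by (auto simp: B_ge1_Beurling_def)
    obtain C where C: "0 < C" "\<And>v x k. norm v \<le> 1 \<Longrightarrow>
        majorizes (fps_deriv (weight_fps M C (\<rho> / 2))) k x (dir_deriv v g)"
      using half(2) weighted_bound_iff_majorizes[OF M(1) half(1) smooth(2)] by blast
    \<comment> \<open>With \<open>C\<close> fixed, this choice makes the growth factor equal to 2,
      which turns \<open>\<rho> / 2\<close> into \<open>\<rho>\<close>.\<close>
    define \<sigma> where "\<sigma> = 1 / ((of_nat DIM(real^'m) * C) * M 1)"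
    have pos: "0 < (of_nat DIM(real^'m) * C) * M 1"
      using C(1) M(1) by (simp add: weight_sequence_def)
    then have "0 < \<sigma>"
      by (simp add: \<sigma>_def)
    moreover have "weighted_bound M \<sigma> f"
      using \<open>0 < \<sigma>\<close> f by (auto simp: B_ge1_Beurling_def)
    ultimately have "weighted_bound M (\<rho> / 2 * (1 + \<sigma> * (of_nat DIM(real^'m) * C) * M 1)) (f \<circ> g)"
      using weighted_bound_comp[OF M smooth half(1) C(1)] C(2) by blast
    also have "\<sigma> * (of_nat DIM(real^'m) * C) * M 1 = 1"
      unfolding \<sigma>_def mult.assoc[of "1 / _"]
      by (rule nonzero_eq_divide_eq[THEN iffD1, OF _ refl]) (use pos in linarith)
    also have "\<rho> / 2 * (1 + 1) = \<rho>"
      by simp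
    finally show ?thesis .
  qed
  then show ?thesis
    using smooth_comp[OF smooth] by (simp add: B_ge1_Beurling_def)
qed

section \<open>Supports\<close>

text \<open>Guarantees that the choice in \<open>multi_deriv\<close> yields a list with the
  prescribed multiplicities.\<close>

lemma ex_list_count:
  fixes \<alpha> :: "'m::finite \<Rightarrow> nat"
  shows "\<exists>js. \<forall>i. count_list js i = \<alpha> i"
proof -
  obtain js where js: "mset js = (\<Sum>i\<in>UNIV. replicate_mset (\<alpha> i) i)"
    using ex_mset by blast
  have "count_list js i = \<alpha> i" for i
    unfolding count_mset[symmetric] js by (simp add: count_sum)
  then show ?thesis
    by blast
qed

text \<open>The counts add up to length 1, so for a unit multi-index the choice in
  \<open>multi_deriv\<close> is forced and gives a first partial derivative.\<close>

lemma count_list_eq_single: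
  fixes i :: "'m::finite"
  assumes "\<forall>j. count_list js j = (if j = i then 1 else 0)"
  shows "js = [i]"
proof -
  have "length js = (\<Sum>j\<in>UNIV. count_list js j)"
    by (simp add: sum_count_set)
  also have "\<dots> = 1"
    using assms by simp
  finally obtain j where "js = [j]"
    by (auto simp: length_Suc_conv)
  then show ?thesis
    using assms[rule_format, of j] by (auto split: if_splits)
qed

text \<open>Derivatives are local, so vanishing on an open set passes to every order.\<close>

lemma frechet_iter_eq_0:
  assumes "open U" "\<And>x. x \<in> U \<Longrightarrow> h x = 0" "x \<in> U"
  shows "frechet_iter h vs x = 0"
  using assms(3)
proof (induction vs arbitrary: x)
  case (Cons v vs)
  have "((\<lambda>x. 0) has_derivative (\<lambda>v. 0)) (at x)"
    by simp
  then have "(frechet_iter h vs has_derivative (\<lambda>v. 0)) (at x)"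
    by (rule has_derivative_transform_within_open[OF _ assms(1) Cons.prems])
      (simp add: Cons.IH)
  then show ?case
    by (simp add: frechet_derivative_at[symmetric])
qed (use assms in auto)

lemma D_ge1_comp:
  fixes f :: "real^'m \<Rightarrow> real^'n" and g :: "real^'l \<Rightarrow> real^'m"
  assumes f: "smooth f" and g: "g \<in> D_ge1"
  shows "f \<circ> g \<in> D_ge1"
proof -
  have "smooth g"
    using g by (simp add: D_ge1_def)
  \<comment> \<open>The union of the supports of the first partial derivatives of \<open>g\<close>.
    It will contain the supports of all derivatives of \<open>f \<circ> g\<close> of order at least
    1.\<close>
  define K where "K = (\<Union>i. closure {x. dir_deriv (axis i 1) g x \<noteq> 0})"
  have "compact (closure {x. dir_deriv (axis i 1) g x \<noteq> 0})" for i
  proof -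
    define \<alpha> :: "'l \<Rightarrow> nat" where "\<alpha> j = (if j = i then 1 else 0)" for j
    have "(SOME js. \<forall>i. count_list js i = \<alpha> i) = [i]"
      using someI_ex[OF ex_list_count[of \<alpha>]] by (intro count_list_eq_single) (simp add: \<alpha>_def)
    then have "multi_deriv \<alpha> g = dir_deriv (axis i 1) g"
      by (simp add: multi_deriv_def dir_deriv_def)
    moreover have "(\<Sum>i\<in>UNIV. \<alpha> i) \<ge> 1"
      by (simp add: \<alpha>_def)
    ultimately show ?thesis
      using g by (auto simp: D_ge1_def test_maps_def)
  qed
  then have "compact K"
    unfolding K_def by (intro compact_UN) auto
  have g0: "dir_deriv v g x = 0" if "x \<notin> K" for v x
  proof -
    have "dir_deriv (axis i 1) g x = 0" for i
    proof (rule ccontr)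
      assume "dir_deriv (axis i 1) g x \<noteq> 0"
      then have "x \<in> closure {x. dir_deriv (axis i 1) g x \<noteq> 0}"
        by (intro closure_subset[THEN subsetD]) simp
      with that show False
        unfolding K_def by blast
    qed
    then have "dir_deriv b g x = 0" if "b \<in> Basis" for b
      using that by (auto simp: Basis_vec_def)
    then show ?thesis
      using dir_deriv_euclidean_expand[OF smooth_differentiable[OF \<open>smooth g\<close>], of v x] by simp
  qed
  have fg0: "dir_deriv v (f \<circ> g) x = 0" if "x \<notin> K" for v x
    using g0[OF that] f \<open>smooth g\<close> by (simp add: dir_deriv_comp smooth_differentiable)
  have "multi_deriv \<alpha> (f \<circ> g) \<in> test_maps" if "(\<Sum>i\<in>UNIV. \<alpha> i) \<ge> 1" for \<alpha> :: "'l \<Rightarrow> nat"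
  proof -
    define js where "js = (SOME js. \<forall>i. count_list js i = \<alpha> i)"
    have "\<forall>i. count_list js i = \<alpha> i"
      unfolding js_def using ex_list_count by (rule someI_ex)
    with that have "js \<noteq> []"
      by auto
    \<comment> \<open>The last index is the innermost differentiation, which already vanishes on the
      open complement of \<open>K\<close>; the remaining ones preserve this.\<close>
    then obtain ks i where js: "js = ks @ [i]"
      by (cases js rule: rev_cases) auto
    have eq: "multi_deriv \<alpha> (f \<circ> g) =
        frechet_iter (dir_deriv (axis i 1) (f \<circ> g)) (map (\<lambda>i. axis i 1) ks)"
      unfolding multi_deriv_def js_def[symmetric] js by (simp add: frechet_iter_snoc)
    have "multi_deriv \<alpha> (f \<circ> g) x = 0" if "x \<notin> K" for x
      unfolding eq using that fg0 compact_imp_closed[OF \<open>compact K\<close>]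
      by (intro frechet_iter_eq_0[where U = "- K"]) auto
    then have "closure {x. multi_deriv \<alpha> (f \<circ> g) x \<noteq> 0} \<subseteq> K"
      using compact_imp_closed[OF \<open>compact K\<close>] by (intro closure_minimal) auto
    then have "compact (closure {x. multi_deriv \<alpha> (f \<circ> g) x \<noteq> 0})"
      using \<open>compact K\<close> by (metis closed_closure compact_Int_closed inf.absorb2)
    moreover have "smooth (multi_deriv \<alpha> (f \<circ> g))"
      unfolding multi_deriv_def using smooth_frechet_iter smooth_comp f \<open>smooth g\<close> by blast
    ultimately show ?thesis
      by (simp add: test_maps_def)
  qed
  then show ?thesis
    using smooth_comp[OF f \<open>smooth g\<close>] by (simp add: D_ge1_def)
qed

theorem mainTheorem13:
  fixes M :: "nat \<Rightarrow> real"
    and f :: "real^'m \<Rightarrow> real^'n"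
    and g :: "real^'l \<Rightarrow> real^'m"
  assumes "weight_sequence M" and "log_convex M"
  shows "(f \<in> B_ge1 \<and> g \<in> D_ge1 \<longrightarrow> f \<circ> g \<in> D_ge1)
    \<and> (f \<in> B_ge1_Beurling M \<and> g \<in> D_ge1_Beurling M \<longrightarrow> f \<circ> g \<in> D_ge1_Beurling M)
    \<and> (f \<in> B_ge1_Roumieu M \<and> g \<in> D_ge1_Roumieu M \<longrightarrow> f \<circ> g \<in> D_ge1_Roumieu M)"
proof (intro conjI impI)
  assume "f \<in> B_ge1 \<and> g \<in> D_ge1"
  then show "f \<circ> g \<in> D_ge1"
    by (intro D_ge1_comp) (auto simp: B_ge1_def)
next
  assume "f \<in> B_ge1_Beurling M \<and> g \<in> D_ge1_Beurling M"
  then show "f \<circ> g \<in> D_ge1_Beurling M"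
    using D_ge1_comp[of f g] B_ge1_Beurling_comp[OF assms, of f g]
    by (auto simp: D_ge1_Beurling_def B_ge1_Beurling_def)
next
  assume "f \<in> B_ge1_Roumieu M \<and> g \<in> D_ge1_Roumieu M"
  then show "f \<circ> g \<in> D_ge1_Roumieu M"
    using D_ge1_comp[of f g] B_ge1_Roumieu_comp[OF assms, of f g]
    by (auto simp: D_ge1_Roumieu_def B_ge1_Roumieu_def)
qed

end
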